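(* Let $\mathbb{F}$ be a field. Let $u$ and $v$ be inner functions, and suppose there is a Möbius transformation $\varphi$ of the unit disk $\mathbb{D}$ (a conformal automorphism of $\mathbb{D}$) such that $v(z)=u(\varphi(z))$. Then the persistence modules $\mathbb{U}$ and $\mathbb{V}$ induced by $u$ and $v$ are isomorphic: $\mathbb{U}\cong\mathbb{V}$.
   Context: An inner function is a bounded analytic function on the open unit disk $\mathbb{D}$ with unimodular radial limits almost everywhere on $\partial\mathbb{D}$. Persistence module (over $\mathbb{F}$): vector spaces $\{V_t\}_{t\in\mathbb{R}}$ with linear maps $\pi_{s,t}:V_s\to V_t$ ($s\le t$) satisfying $\pi_{s,r}=\pi_{t,r}\circ\pi_{s,t}$, $\pi_{t,t}=\mathrm{id}$, and $V_s=0$ for all sufficiently small $s$. A morphism is a family of linear maps commuting with the structure maps; an isomorphism is a morphism with a two-sided inverse morphism. Persistence module induced by an inner function $u$: for $t>0$ let $\theta(t)=\frac{e^t-1}{e^t+1}$ and $\Sigma_{u,t}=\{z\in\mathbb{D}:|u(z)|<\theta(t)\}$; $V_t=H_0(\Sigma_{u,t};\mathbb{F})$ for $t>0$ (all higher homology vanishes), $V_t=0$ for $t\le0$, and $\pi_{s,t}$ is induced by the inclusion $\Sigma_{u,s}\hookrightarrow\Sigma_{u,t}$ for $0<s\le t$. *)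

theory Defs
  imports
    "HOL-Complex_Analysis.Complex_Analysis"
    "HOL-Homology.Homology"
    "HOL-Algebra.Algebraic_Closure_Type"
begin

section \<open>Inner functions and automorphisms of the disk\<close>

text \<open>
  Functions on the unit disk are total functions on the complex plane whose values outside
  the disk are irrelevant.
\<close>

definition inner_function :: "(complex \<Rightarrow> complex) \<Rightarrow> bool" where
  "inner_function u \<longleftrightarrow>
     u holomorphic_on ball 0 1 \<and>
     bounded (u ` ball 0 1) \<and>
     (AE x in lebesgue_on {0..2 * pi}.
        \<exists>l. norm l = 1 \<and> ((\<lambda>r. u (complex_of_real r * cis x)) \<longlongrightarrow> l) (at_left 1))"

definition disk_automorphism :: "(complex \<Rightarrow> complex) \<Rightarrow> bool" where
  "disk_automorphism \<phi> \<longleftrightarrow>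
     \<phi> holomorphic_on ball 0 1 \<and> bij_betw \<phi> (ball 0 1) (ball 0 1)"


section \<open>Persistence modules over a field\<close>

text \<open>
  Vector spaces over a field \<open>F\<close> are modules in the sense of \<open>HOL-Algebra\<close>. Their record type
  extends the type of rings, but the multiplication and the unit fields play no role.
\<close>

definition linear_map_on ::
    "('f, 'm) ring_scheme \<Rightarrow> ('f, 'v) module \<Rightarrow> ('f, 'w) module \<Rightarrow> ('v \<Rightarrow> 'w) \<Rightarrow> bool" where
  "linear_map_on F M N f \<longleftrightarrow>
     f \<in> carrier M \<rightarrow> carrier N \<and>
     (\<forall>x\<in>carrier M. \<forall>y\<in>carrier M. f (x \<oplus>\<^bsub>M\<^esub> y) = f x \<oplus>\<^bsub>N\<^esub> f y) \<and>
     (\<forall>a\<in>carrier F. \<forall>x\<in>carrier M. f (a \<odot>\<^bsub>M\<^esub> x) = a \<odot>\<^bsub>N\<^esub> f x)"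

record ('f, 'v) persistence =
  vspace :: "real \<Rightarrow> ('f, 'v) module"
  transition :: "real \<Rightarrow> real \<Rightarrow> 'v \<Rightarrow> 'v"

definition persistence_module :: "('f, 'm) ring_scheme \<Rightarrow> ('f, 'v) persistence \<Rightarrow> bool" where
  "persistence_module F V \<longleftrightarrow>
     Ring.field F \<and>
     (\<forall>t. Module.module F (vspace V t)) \<and>
     (\<forall>s t. s \<le> t \<longrightarrow> linear_map_on F (vspace V s) (vspace V t) (transition V s t)) \<and>
     (\<forall>s t r. s \<le> t \<longrightarrow> t \<le> r \<longrightarrow>
        (\<forall>x\<in>carrier (vspace V s). transition V s r x = transition V t r (transition V s t x))) \<and>
     (\<forall>t. \<forall>x\<in>carrier (vspace V t). transition V t t x = x) \<and>
     (\<exists>s\<^sub>0. \<forall>s\<le>s\<^sub>0. carrier (vspace V s) = {\<zero>\<^bsub>vspace V s\<^esub>})"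

definition persistence_morphism ::
    "('f, 'm) ring_scheme \<Rightarrow> ('f, 'v) persistence \<Rightarrow> ('f, 'w) persistence \<Rightarrow>
     (real \<Rightarrow> 'v \<Rightarrow> 'w) \<Rightarrow> bool" where
  "persistence_morphism F V W f \<longleftrightarrow>
     (\<forall>t. linear_map_on F (vspace V t) (vspace W t) (f t)) \<and>
     (\<forall>s t. s \<le> t \<longrightarrow>
        (\<forall>x\<in>carrier (vspace V s). f t (transition V s t x) = transition W s t (f s x)))"

definition persistence_isomorphic ::
    "('f, 'm) ring_scheme \<Rightarrow> ('f, 'v) persistence \<Rightarrow> ('f, 'w) persistence \<Rightarrow> bool" where
  "persistence_isomorphic F V W \<longleftrightarrow>
     persistence_module F V \<and> persistence_module F W \<and>
     (\<exists>f g. persistence_morphism F V W f \<and> persistence_morphism F W V g \<and>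
        (\<forall>t. \<forall>x\<in>carrier (vspace V t). g t (f t x) = x) \<and>
        (\<forall>t. \<forall>y\<in>carrier (vspace W t). f t (g t y) = y))"


section \<open>Singular homology with field coefficients\<close>

text \<open>
  \<open>HOL-Homology\<close> only provides integer coefficients. The following repeats its construction with
  coefficients in a field, on top of the library's singular simplices.
\<close>

type_synonym ('a, 'f) field_chain = "((nat \<Rightarrow> real) \<Rightarrow> 'a) \<Rightarrow>\<^sub>0 'f"

definition chain_module :: "nat \<Rightarrow> 'a topology \<Rightarrow> ('f::field, ('a, 'f) field_chain) module" where
  "chain_module p T =
     \<lparr>carrier = {c. Poly_Mapping.keys c \<subseteq> singular_simplex_set p T},
      monoid.mult = undefined, one = undefined, ring.zero = 0, add = (+),
      smult = (\<lambda>a. Poly_Mapping.map ((*) a))\<rparr>"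

definition field_chain_boundary ::
    "nat \<Rightarrow> ('a, 'f::field) field_chain \<Rightarrow> ('a, 'f) field_chain" where
  "field_chain_boundary p c =
     (if p = 0 then 0
      else \<Sum>\<sigma>\<in>Poly_Mapping.keys c. \<Sum>k\<le>p.
             Poly_Mapping.single (singular_face p k \<sigma>) ((-1) ^ k * Poly_Mapping.lookup c \<sigma>))"

definition field_chain_map ::
    "nat \<Rightarrow> ('a \<Rightarrow> 'b) \<Rightarrow> ('a, 'f::field) field_chain \<Rightarrow> ('b, 'f) field_chain" where
  "field_chain_map p g c =
     (\<Sum>\<sigma>\<in>Poly_Mapping.keys c.
        Poly_Mapping.single (simplex_map p g \<sigma>) (Poly_Mapping.lookup c \<sigma>))"

definition field_cycles :: "nat \<Rightarrow> 'a topology \<Rightarrow> ('a, 'f::field) field_chain set" where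
  "field_cycles p T = {c \<in> carrier (chain_module p T). field_chain_boundary p c = 0}"

definition field_boundaries :: "nat \<Rightarrow> 'a topology \<Rightarrow> ('a, 'f::field) field_chain set" where
  "field_boundaries p T = field_chain_boundary (Suc p) ` carrier (chain_module (Suc p) T)"

definition quotient_module :: "('f, 'v) module \<Rightarrow> 'v set \<Rightarrow> ('f, 'v set) module" where
  "quotient_module M N =
     \<lparr>carrier = a_rcosets\<^bsub>M\<^esub> N,
      monoid.mult = undefined, one = undefined, ring.zero = N, add = set_add M,
      smult = (\<lambda>a A. \<Union>x\<in>A. N +>\<^bsub>M\<^esub> (a \<odot>\<^bsub>M\<^esub> x))\<rparr>"

definition homology_module ::
    "nat \<Rightarrow> 'a topology \<Rightarrow> ('f::field, ('a, 'f) field_chain set) module" where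
  "homology_module p T =
     quotient_module ((chain_module p T)\<lparr>carrier := field_cycles p T\<rparr>) (field_boundaries p T)"

text \<open>
  The map induced on \<open>H\<^sub>p\<close> by a continuous map \<open>g\<close> into \<open>T\<close>: a class is sent to the class of the
  image of any of its representatives. All the cosets in the union coincide.
\<close>

definition homology_map ::
    "nat \<Rightarrow> 'b topology \<Rightarrow> ('a \<Rightarrow> 'b) \<Rightarrow>
     ('a, 'f::field) field_chain set \<Rightarrow> ('b, 'f) field_chain set" where
  "homology_map p T g A =
     (\<Union>c\<in>A. field_boundaries p T +>\<^bsub>chain_module p T\<^esub> field_chain_map p g c)"


section \<open>The persistence module of an inner function\<close>

definition theta :: "real \<Rightarrow> real" where
  "theta t = (exp t - 1) / (exp t + 1)"

definition sublevel :: "(complex \<Rightarrow> complex) \<Rightarrow> real \<Rightarrow> complex set" where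
  "sublevel u t = {z \<in> ball 0 1. norm (u z) < theta t}"

text \<open>Homology classes are sets of chains, so a one-element carrier of that type is \<open>{{0}}\<close>.\<close>

definition zero_homology :: "('f::field, ('a, 'f) field_chain set) module" where
  "zero_homology =
     \<lparr>carrier = {{0}}, monoid.mult = undefined, one = undefined, ring.zero = {0},
      add = (\<lambda>A B. {0}), smult = (\<lambda>a A. {0})\<rparr>"

definition induced_space ::
    "(complex \<Rightarrow> complex) \<Rightarrow> real \<Rightarrow> ('f::field, (complex, 'f) field_chain set) module" where
  "induced_space u t =
     (if t > 0 then homology_module 0 (top_of_set (sublevel u t)) else zero_homology)"

definition induced_persistence ::
    "(complex \<Rightarrow> complex) \<Rightarrow> ('f::field, (complex, 'f) field_chain set) persistence" where
  "induced_persistence u =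
     \<lparr>vspace = induced_space u,
      transition = (\<lambda>s t. if s > 0 then homology_map 0 (top_of_set (sublevel u t)) (\<lambda>z. z)
                          else (\<lambda>A. \<zero>\<^bsub>induced_space u t :: ('f, _) module\<^esub>))\<rparr>"

end

theory Submission
  imports Defs
begin

text \<open>Since v = u o \<phi>, the bijection \<phi> of the disk carries {|v| < \<theta>(t)} onto
  {|u| < \<theta>(t)} for every t. One and the same map works at all levels, so it commutes with the
  inclusions between them. Its inverse \<psi> is continuous as well, and functoriality of H_0 turns
  \<phi> and \<psi> into mutually inverse families of linear maps that commute with the transitions:
  an isomorphism of persistence modules.

  The geometric input is \<open>continuous_map_sublevel\<close>. It feeds
  \<open>persistence_morphism_induced_map\<close> and \<open>induced_map_inverse\<close>, both
  consequences of functoriality (\<open>homology_map_0_compose\<close>,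
  \<open>homology_map_0_ident\<close>). Functoriality comes from the chain level: pushing chains
  forward is linear, functorial, and maps boundaries to boundaries. The bridge from chains to
  classes is \<open>UN_rcoset_linear\<close>, which evaluates a map of classes on any
  representative. For t \<le> 0 all spaces are zero, and it only has to be checked that linear maps
  preserve zero.\<close>

section \<open>Quotient modules\<close>

lemma abelian_subgroup_of_submodule:
  assumes "Module.module F M" and "submodule N F M"
  shows "abelian_subgroup N M"
proof -
  interpret module F M by fact
  interpret submodule N F M by fact
  show ?thesis
    using abelian_subgroupI2 a_comm_group subgroup_axioms by blast
qed

lemma carrier_quotient_module:
  "carrier (quotient_module M N) = (\<lambda>x. N +>\<^bsub>M\<^esub> x) ` carrier M"
  by (auto simp: quotient_module_def A_RCOSETS_def')

lemma add_quotient_module: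
  assumes "Module.module F M" and "submodule N F M" and "x \<in> carrier M" and "y \<in> carrier M"
  shows "(N +>\<^bsub>M\<^esub> x) \<oplus>\<^bsub>quotient_module M N\<^esub> (N +>\<^bsub>M\<^esub> y) = N +>\<^bsub>M\<^esub> (x \<oplus>\<^bsub>M\<^esub> y)"
  using abelian_subgroup.a_rcos_sum[OF abelian_subgroup_of_submodule] assms
  by (simp add: quotient_module_def)

text \<open>Puts zero in coset form too, so that every law in the quotient can be checked on
  representatives.\<close>

lemma zero_quotient_module:
  assumes "Module.module F M" and "submodule N F M"
  shows "\<zero>\<^bsub>quotient_module M N\<^esub> = N +>\<^bsub>M\<^esub> \<zero>\<^bsub>M\<^esub>"
proof -
  interpret module F M by fact
  interpret N: submodule N F M by fact
  show ?thesis
    using M.a_coset_add_zero N.subset by (simp add: quotient_module_def)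
qed

lemma rcoset_absorb:
  assumes "Module.module F M" and "submodule N F M" and "n \<in> N" and "x \<in> carrier M"
  shows "N +>\<^bsub>M\<^esub> (n \<oplus>\<^bsub>M\<^esub> x) = N +>\<^bsub>M\<^esub> x"
proof -
  interpret N: abelian_subgroup N M
    using assms abelian_subgroup_of_submodule by blast
  have "n \<oplus>\<^bsub>M\<^esub> x \<in> N +>\<^bsub>M\<^esub> x"
    using assms by (auto simp: a_r_coset_def')
  then show ?thesis
    using N.a_repr_independence assms N.a_subgroup by metis
qed

text \<open>Well-definedness of the map induced on quotients. Another representative is n + x with n
  in \<open>N\<close>, and f n lies in \<open>N'\<close>, so all cosets in the union coincide; the
  union is over a nonempty set. It evaluates both the scalar multiplication of
  \<open>quotient_module\<close> and \<open>homology_map\<close>, which are defined as such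
  unions.\<close>

lemma UN_rcoset_linear:
  assumes M: "Module.module F M" "submodule N F M"
    and M': "Module.module F M'" "submodule N' F M'"
    and f: "linear_map_on F M M' f" and N: "f ` N \<subseteq> N'" and x: "x \<in> carrier M"
  shows "(\<Union>y\<in>N +>\<^bsub>M\<^esub> x. N' +>\<^bsub>M'\<^esub> f y) = N' +>\<^bsub>M'\<^esub> f x"
proof -
  interpret N: abelian_subgroup N M
    using M abelian_subgroup_of_submodule by blast
  have "N' +>\<^bsub>M'\<^esub> f y = N' +>\<^bsub>M'\<^esub> f x" if y: "y \<in> N +>\<^bsub>M\<^esub> x" for y
  proof -
    obtain n where n: "n \<in> N" "y = n \<oplus>\<^bsub>M\<^esub> x"
      using y by (auto simp: a_r_coset_def')
    then have "f y = f n \<oplus>\<^bsub>M'\<^esub> f x"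
      using f x N.a_subset by (auto simp: linear_map_on_def)
    moreover have "f n \<in> N'" "f x \<in> carrier M'"
      using n N f x by (auto simp: linear_map_on_def)
    ultimately show ?thesis
      using rcoset_absorb[OF M'] by simp
  qed
  moreover have "N +>\<^bsub>M\<^esub> x \<noteq> {}"
    using N.a_rcos_self[OF x] by blast
  ultimately show ?thesis
    by (intro SUP_eq_const)
qed

lemma smult_quotient_module:
  assumes M: "Module.module F M" "submodule N F M" and a: "a \<in> carrier F" and x: "x \<in> carrier M"
  shows "a \<odot>\<^bsub>quotient_module M N\<^esub> (N +>\<^bsub>M\<^esub> x) = N +>\<^bsub>M\<^esub> (a \<odot>\<^bsub>M\<^esub> x)"
proof -
  interpret module F M by fact
  interpret N: submodule N F M by fact
  \<comment> \<open>Commutativity of the scalars makes multiplication by \<open>a\<close> a linear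
    map.\<close>
  have "linear_map_on F M M (\<lambda>y. a \<odot>\<^bsub>M\<^esub> y)"
    using a by (auto simp: linear_map_on_def smult_r_distr smult_assoc1[symmetric] m_comm)
  moreover have "(\<lambda>y. a \<odot>\<^bsub>M\<^esub> y) ` N \<subseteq> N"
    using a by auto
  ultimately show ?thesis
    using UN_rcoset_linear[OF M M] x by (simp add: quotient_module_def)
qed

text \<open>Each axiom is inherited from \<open>M\<close>: choose representatives, compute with the
  three coset formulas, and apply the axiom in \<open>M\<close>.\<close>

lemma module_quotient_module:
  assumes M: "Module.module F M" "submodule N F M"
  shows "Module.module F (quotient_module M N)"
proof -
  interpret module F M by fact
  let ?Q = "quotient_module M N"
  have cases: "\<exists>x\<in>carrier M. A = N +>\<^bsub>M\<^esub> x" if "A \<in> carrier ?Q" for A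
    using that by (auto simp: carrier_quotient_module)
  have closed: "N +>\<^bsub>M\<^esub> x \<in> carrier ?Q" if "x \<in> carrier M" for x
    using that by (simp add: carrier_quotient_module)
  note add = add_quotient_module[OF M] and zero = zero_quotient_module[OF M]
    and smult = smult_quotient_module[OF M]
  have group: "abelian_group ?Q"
  proof (rule abelian_groupI)
    show "\<zero>\<^bsub>?Q\<^esub> \<in> carrier ?Q"
      unfolding zero by (rule closed) simp
  next
    fix A assume "A \<in> carrier ?Q"
    then obtain x where x: "x \<in> carrier M" "A = N +>\<^bsub>M\<^esub> x"
      using cases by blast
    then show "\<zero>\<^bsub>?Q\<^esub> \<oplus>\<^bsub>?Q\<^esub> A = A"
      unfolding zero by (simp add: add)
    show "\<exists>B\<in>carrier ?Q. B \<oplus>\<^bsub>?Q\<^esub> A = \<zero>\<^bsub>?Q\<^esub>"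
      using x closed[of "\<ominus>\<^bsub>M\<^esub> x"] unfolding zero
      by (intro bexI[of _ "N +>\<^bsub>M\<^esub> (\<ominus>\<^bsub>M\<^esub> x)"]) (simp_all add: add M.l_neg)
  next
    fix A B assume "A \<in> carrier ?Q" "B \<in> carrier ?Q"
    then obtain x y where x: "x \<in> carrier M" "A = N +>\<^bsub>M\<^esub> x" "y \<in> carrier M" "B = N +>\<^bsub>M\<^esub> y"
      using cases by blast
    then show "A \<oplus>\<^bsub>?Q\<^esub> B \<in> carrier ?Q" "A \<oplus>\<^bsub>?Q\<^esub> B = B \<oplus>\<^bsub>?Q\<^esub> A"
      using M.a_comm[of x y] by (simp_all add: add closed)
    fix C assume "C \<in> carrier ?Q"
    then obtain z where "z \<in> carrier M" "C = N +>\<^bsub>M\<^esub> z"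
      using cases by blast
    then show "A \<oplus>\<^bsub>?Q\<^esub> B \<oplus>\<^bsub>?Q\<^esub> C = A \<oplus>\<^bsub>?Q\<^esub> (B \<oplus>\<^bsub>?Q\<^esub> C)"
      using x by (simp add: add M.a_assoc)
  qed
  show ?thesis
  proof (rule moduleI[OF R.cring_axioms group])
    fix a A assume a: "a \<in> carrier F" and "A \<in> carrier ?Q"
    then obtain x where x: "x \<in> carrier M" "A = N +>\<^bsub>M\<^esub> x"
      using cases by blast
    with a show "a \<odot>\<^bsub>?Q\<^esub> A \<in> carrier ?Q"
      by (simp add: smult closed)
    fix b assume "b \<in> carrier F"
    with a x show "(a \<oplus>\<^bsub>F\<^esub> b) \<odot>\<^bsub>?Q\<^esub> A = a \<odot>\<^bsub>?Q\<^esub> A \<oplus>\<^bsub>?Q\<^esub> b \<odot>\<^bsub>?Q\<^esub> A"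
      and "(a \<otimes>\<^bsub>F\<^esub> b) \<odot>\<^bsub>?Q\<^esub> A = a \<odot>\<^bsub>?Q\<^esub> (b \<odot>\<^bsub>?Q\<^esub> A)"
      by (simp_all add: smult add smult_l_distr smult_assoc1)
  next
    fix a A B assume "a \<in> carrier F" "A \<in> carrier ?Q" "B \<in> carrier ?Q"
    moreover from this obtain x y
      where "x \<in> carrier M" "A = N +>\<^bsub>M\<^esub> x" "y \<in> carrier M" "B = N +>\<^bsub>M\<^esub> y"
      using cases by blast
    ultimately show "a \<odot>\<^bsub>?Q\<^esub> (A \<oplus>\<^bsub>?Q\<^esub> B) = a \<odot>\<^bsub>?Q\<^esub> A \<oplus>\<^bsub>?Q\<^esub> a \<odot>\<^bsub>?Q\<^esub> B"
      by (simp add: smult add smult_r_distr)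
  next
    fix A assume "A \<in> carrier ?Q"
    then obtain x where "x \<in> carrier M" "A = N +>\<^bsub>M\<^esub> x"
      using cases by blast
    then show "\<one>\<^bsub>F\<^esub> \<odot>\<^bsub>?Q\<^esub> A = A"
      by (simp add: smult)
  qed
qed


section \<open>Singular chains over a field: linearity, boundaries and functoriality\<close>

section \<open>Field chains\<close>

lemma lookup_scale [simp]:
  fixes c :: "'k \<Rightarrow>\<^sub>0 'f::field"
  shows "Poly_Mapping.lookup (Poly_Mapping.map ((*) a) c) k = a * Poly_Mapping.lookup c k"
  by (simp add: Poly_Mapping.map.rep_eq when_def)

lemma scale_0 [simp]: "Poly_Mapping.map ((*) a) 0 = (0 :: 'k \<Rightarrow>\<^sub>0 'f::field)"
  by (rule poly_mapping_eqI) simp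

lemma scale_sum:
  fixes c :: "'i \<Rightarrow> 'k \<Rightarrow>\<^sub>0 'f::field"
  shows "Poly_Mapping.map ((*) a) (\<Sum>i\<in>I. c i) = (\<Sum>i\<in>I. Poly_Mapping.map ((*) a) (c i))"
  by (rule poly_mapping_eqI) (simp add: lookup_sum sum_distrib_left)

lemma scale_single [simp]:
  fixes b :: "'f::field"
  shows "Poly_Mapping.map ((*) a) (Poly_Mapping.single k b) = Poly_Mapping.single k (a * b)"
  by (rule poly_mapping_eqI) (simp add: lookup_single when_def)

lemma keys_scale_subset:
  fixes c :: "'k \<Rightarrow>\<^sub>0 'f::field"
  shows "Poly_Mapping.keys (Poly_Mapping.map ((*) a) c) \<subseteq> Poly_Mapping.keys c"
  by (auto simp: in_keys_iff)

text \<open>Expands a chain in the basis of simplices, which reduces linear identities to single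
  simplices.\<close>

lemma sum_keys_single_id:
  fixes c :: "'k \<Rightarrow>\<^sub>0 'f::field"
  shows "(\<Sum>k\<in>Poly_Mapping.keys c. Poly_Mapping.single k (Poly_Mapping.lookup c k)) = c"
  by (rule poly_mapping_eqI)
    (auto simp: lookup_sum lookup_single when_def in_keys_iff)

lemma field_chain_boundary_0 [simp]: "field_chain_boundary p 0 = 0"
  by (simp add: field_chain_boundary_def)

text \<open>Cancellation can make the support of c + d smaller than the union of the supports.
  Splitting the sum is still sound because the summand is additive in the coefficient and vanishes
  at coefficient 0.\<close>

lemma field_chain_boundary_add:
  "field_chain_boundary p (c + d) = field_chain_boundary p c + field_chain_boundary p d"
  by (auto simp: field_chain_boundary_def single_add distrib_left sum.distrib
      intro!: setsum_keys_plus_distrib)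

lemma field_chain_boundary_sum:
  "field_chain_boundary p (\<Sum>i\<in>I. c i) = (\<Sum>i\<in>I. field_chain_boundary p (c i))"
  by (induction I rule: infinite_finite_induct) (auto simp: field_chain_boundary_add)

lemma field_chain_boundary_single:
  assumes "p > 0"
  shows "field_chain_boundary p (Poly_Mapping.single \<sigma> a) =
    (\<Sum>k\<le>p. Poly_Mapping.single (singular_face p k \<sigma>) ((-1) ^ k * a))"
  using assms by (simp add: field_chain_boundary_def)

lemma field_chain_boundary_scale:
  "field_chain_boundary p (Poly_Mapping.map ((*) a) c) =
    Poly_Mapping.map ((*) a) (field_chain_boundary p c)"
proof (cases "p = 0")
  case False
  \<comment> \<open>Scaling by a = 0 shrinks the support, so the scaled chain is expanded over the
    keys of \<open>c\<close> rather than over its own.\<close>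
  have "field_chain_boundary p (Poly_Mapping.map ((*) a) c) =
      field_chain_boundary p (\<Sum>\<sigma>\<in>Poly_Mapping.keys c.
        Poly_Mapping.single \<sigma> (a * Poly_Mapping.lookup c \<sigma>))"
    by (subst (1) sum_keys_single_id[of c, symmetric]) (simp add: scale_sum)
  with False show ?thesis
    by (simp add: field_chain_boundary_sum field_chain_boundary_single)
      (simp add: field_chain_boundary_def scale_sum mult.left_commute)
qed (simp add: field_chain_boundary_def)

lemma field_chain_map_0 [simp]: "field_chain_map p g 0 = 0"
  by (simp add: field_chain_map_def)

lemma field_chain_map_add:
  "field_chain_map p g (c + d) = field_chain_map p g c + field_chain_map p g d"
  unfolding field_chain_map_def
  by (rule setsum_keys_plus_distrib) (auto simp: single_add)

lemma field_chain_map_sum: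
  "field_chain_map p g (\<Sum>i\<in>I. c i) = (\<Sum>i\<in>I. field_chain_map p g (c i))"
  by (induction I rule: infinite_finite_induct) (auto simp: field_chain_map_add)

lemma field_chain_map_single [simp]:
  "field_chain_map p g (Poly_Mapping.single \<sigma> a) = Poly_Mapping.single (simplex_map p g \<sigma>) a"
  by (simp add: field_chain_map_def)

lemma field_chain_map_scale:
  "field_chain_map p g (Poly_Mapping.map ((*) a) c) =
    Poly_Mapping.map ((*) a) (field_chain_map p g c)"
proof -
  have "field_chain_map p g (Poly_Mapping.map ((*) a) c) =
      field_chain_map p g (\<Sum>\<sigma>\<in>Poly_Mapping.keys c.
        Poly_Mapping.single \<sigma> (a * Poly_Mapping.lookup c \<sigma>))"
    by (subst (1) sum_keys_single_id[of c, symmetric]) (simp add: scale_sum)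
  then show ?thesis
    by (simp add: field_chain_map_sum) (simp add: field_chain_map_def scale_sum)
qed

lemma field_chain_boundary_chain_map:
  "field_chain_boundary p (field_chain_map p g c) =
    field_chain_map (p - 1) g (field_chain_boundary p c)"
proof (cases "p = 0")
  case False
  \<comment> \<open>A face precomposes with a face inclusion and \<open>simplex_map\<close>
    postcomposes with \<open>g\<close>, so they commute. Both restrict their result to a standard
    simplex, which the face inclusion respects.\<close>
  have "singular_face p k (simplex_map p g \<sigma>) = simplex_map (p - 1) g (singular_face p k \<sigma>)"
    if "k \<le> p" for k \<sigma>
    using that False
    by (fastforce simp: singular_face_def simplex_map_def simplical_face_in_standard_simplex)
  with False show ?thesis
    by (simp add: field_chain_map_def[of p] field_chain_boundary_sum field_chain_boundary_single)
      (simp add: field_chain_boundary_def field_chain_map_sum)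
qed (simp add: field_chain_boundary_def)

lemma carrier_chain_module:
  "carrier (chain_module p T) = {c. Poly_Mapping.keys c \<subseteq> singular_simplex_set p T}"
  by (simp add: chain_module_def)

lemma chain_module_simps [simp]:
  "x \<oplus>\<^bsub>chain_module p T\<^esub> y = x + y"
  "\<zero>\<^bsub>chain_module p T\<^esub> = 0"
  "a \<odot>\<^bsub>chain_module p T\<^esub> x = Poly_Mapping.map ((*) a) x"
  by (simp_all add: chain_module_def)

lemma ring_of_type_algebra_simps [simp]:
  "carrier ring_of_type_algebra = UNIV"
  "a \<oplus>\<^bsub>ring_of_type_algebra\<^esub> b = a + b"
  "a \<otimes>\<^bsub>ring_of_type_algebra\<^esub> b = a * b"
  "\<one>\<^bsub>ring_of_type_algebra\<^esub> = 1"
  by (simp_all add: ring_of_type_algebra_def)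

text \<open>Simplices take values in the space, so the maps need to agree only there. This suits
  functions on the disk, whose values elsewhere are arbitrary.\<close>

lemma field_chain_map_compose:
  assumes "c \<in> carrier (chain_module p T)"
    and "\<And>x. x \<in> topspace T \<Longrightarrow> g' (g x) = h x"
  shows "field_chain_map p g' (field_chain_map p g c) = field_chain_map p h c"
proof -
  have "simplex_map p g' (simplex_map p g \<sigma>) = simplex_map p h \<sigma>"
    if "\<sigma> \<in> Poly_Mapping.keys c" for \<sigma>
  proof -
    have "singular_simplex p T \<sigma>"
      using that assms(1) by (auto simp: carrier_chain_module)
    then have "simplex_map p (g' \<circ> g) \<sigma> = simplex_map p h \<sigma>"
      by (rule simplex_map_eq) (simp add: assms(2))
    then show ?thesis
      by (simp add: simplex_map_compose)
  qed
  then show ?thesis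
    by (simp add: field_chain_map_def[of p g] field_chain_map_def[of p h] field_chain_map_sum)
qed

lemma field_chain_map_ident:
  assumes "c \<in> carrier (chain_module p T)"
    and "\<And>x. x \<in> topspace T \<Longrightarrow> g x = x"
  shows "field_chain_map p g c = c"
proof -
  have "simplex_map p g \<sigma> = \<sigma>" if "\<sigma> \<in> Poly_Mapping.keys c" for \<sigma>
    using that assms simplex_map_id_gen[of p T \<sigma> g] by (auto simp: carrier_chain_module)
  then show ?thesis
    by (simp add: field_chain_map_def sum_keys_single_id)
qed

lemma chain_module_carrier_closed:
  shows "0 \<in> carrier (chain_module p T)"
    and "c \<in> carrier (chain_module p T) \<Longrightarrow> d \<in> carrier (chain_module p T) \<Longrightarrow>
      c + d \<in> carrier (chain_module p T)"
    and "c \<in> carrier (chain_module p T) \<Longrightarrow>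
      Poly_Mapping.map ((*) a) c \<in> carrier (chain_module p T)"
  using keys_add[of c d] keys_scale_subset[of a c]
  by (fastforce simp: carrier_chain_module)+

lemma scale_minus_one: "Poly_Mapping.map ((*) (-1)) c + c = (0 :: 'k \<Rightarrow>\<^sub>0 'f::field)"
  by (rule poly_mapping_eqI) (simp add: lookup_add)

lemma module_chain_module:
  "Module.module ring_of_type_algebra (chain_module p T :: ('f::field, ('a, 'f) field_chain) module)"
proof (rule moduleI)
  show "cring (ring_of_type_algebra :: 'f ring)"
    by (rule cring_from_type_algebra)
  show "abelian_group (chain_module p T :: ('f, ('a, 'f) field_chain) module)"
  proof (rule abelian_groupI)
    fix x :: "('a, 'f) field_chain" assume "x \<in> carrier (chain_module p T)"
    then show "\<exists>y\<in>carrier (chain_module p T). y \<oplus>\<^bsub>chain_module p T\<^esub> x = \<zero>\<^bsub>chain_module p T\<^esub>"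
      using chain_module_carrier_closed(3) scale_minus_one
      by (intro bexI[of _ "Poly_Mapping.map ((*) (-1)) x"]) auto
  qed (auto simp: chain_module_carrier_closed ac_simps)
qed (auto simp: chain_module_carrier_closed lookup_add algebra_simps intro!: poly_mapping_eqI)

lemma field_chain_boundary_in_carrier:
  assumes "c \<in> carrier (chain_module (Suc p) T)"
  shows "field_chain_boundary (Suc p) c \<in> carrier (chain_module p T)"
proof -
  have "singular_face (Suc p) k \<sigma> \<in> singular_simplex_set p T"
    if "\<sigma> \<in> Poly_Mapping.keys c" "k \<le> Suc p" for \<sigma> k
    using that assms singular_simplex_singular_face[of "Suc p" T \<sigma> k]
    by (auto simp: carrier_chain_module)
  then show ?thesis
    unfolding carrier_chain_module mem_Collect_eq field_chain_boundary_def
    by (auto dest!: keys_sum[THEN subsetD] split: if_splits simp del: sum.atMost_Suc)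
qed

lemma field_chain_map_in_carrier:
  assumes "c \<in> carrier (chain_module p S)" and "continuous_map S T g"
  shows "field_chain_map p g c \<in> carrier (chain_module p T)"
  using assms singular_simplex_simplex_map[of p S _ T g]
  unfolding carrier_chain_module mem_Collect_eq field_chain_map_def
  by (fastforce dest!: keys_sum[THEN subsetD] split: if_splits)

lemma linear_field_chain_map:
  assumes "continuous_map S T g"
  shows "linear_map_on ring_of_type_algebra (chain_module p S) (chain_module p T)
    (field_chain_map p g)"
  using field_chain_map_in_carrier[OF _ assms]
  by (auto simp: linear_map_on_def field_chain_map_add field_chain_map_scale)

text \<open>The chain map property; it makes the induced map on homology independent of the
  representative.\<close>

lemma field_chain_map_boundaries:
  assumes "continuous_map S T g"
  shows "field_chain_map p g ` field_boundaries p S \<subseteq> field_boundaries p T"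
proof clarify
  fix b assume "b \<in> field_boundaries p S"
  then obtain c where c: "c \<in> carrier (chain_module (Suc p) S)" "b = field_chain_boundary (Suc p) c"
    by (auto simp: field_boundaries_def)
  then have "field_chain_map p g b = field_chain_boundary (Suc p) (field_chain_map (Suc p) g c)"
    by (simp add: field_chain_boundary_chain_map)
  then show "field_chain_map p g b \<in> field_boundaries p T"
    using field_chain_map_in_carrier[OF c(1) assms] by (auto simp: field_boundaries_def)
qed

lemma submodule_field_boundaries:
  "submodule (field_boundaries p T) ring_of_type_algebra
    (chain_module p T :: ('f::field, ('a, 'f) field_chain) module)"
proof -
  let ?M = "chain_module p T :: ('f, ('a, 'f) field_chain) module"
  let ?B = "field_boundaries p T :: ('a, 'f) field_chain set"
  interpret module ring_of_type_algebra ?M by (rule module_chain_module)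
  have smult: "Poly_Mapping.map ((*) a) x \<in> ?B" if "x \<in> ?B" for a x
    using that by (auto simp: field_boundaries_def field_chain_boundary_scale[symmetric]
        intro!: imageI chain_module_carrier_closed)
  have sub: "?B \<subseteq> carrier ?M"
    by (auto simp: field_boundaries_def field_chain_boundary_in_carrier)
  show ?thesis
  proof (rule submoduleI)
    show "\<zero>\<^bsub>?M\<^esub> \<in> ?B"
      unfolding field_boundaries_def
      by (rule image_eqI[of _ _ 0]) (auto simp: chain_module_carrier_closed)
    show "\<ominus>\<^bsub>?M\<^esub> x \<in> ?B" if "x \<in> ?B" for x
    proof -
      have "x \<in> carrier ?M" using sub that by blast
      \<comment> \<open>Uniqueness of additive inverses identifies negation in the module with
        scaling by -1, so closure under scaling suffices.\<close>
      then have "\<ominus>\<^bsub>?M\<^esub> x = Poly_Mapping.map ((*) (-1)) x"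
        by (intro M.minus_equality) (auto simp: scale_minus_one chain_module_carrier_closed)
      then show ?thesis using smult that by simp
    qed
    show "x \<oplus>\<^bsub>?M\<^esub> y \<in> ?B" if "x \<in> ?B" "y \<in> ?B" for x y
      using that by (auto simp: field_boundaries_def field_chain_boundary_add[symmetric]
          intro!: imageI chain_module_carrier_closed)
  qed (use smult sub in auto)
qed


section \<open>H_0 as a functor on spaces and continuous maps\<close>

section \<open>Homology in degree zero\<close>

text \<open>The boundary in degree 0 is zero, so every 0-chain is a cycle and H_0 is a quotient of
  the whole chain module. The identity that a boundary has zero boundary never enters.\<close>

lemma homology_module_0:
  "homology_module 0 T =
    quotient_module (chain_module 0 T :: ('f::field, ('a, 'f) field_chain) module)
      (field_boundaries 0 T)"
proof -
  have "field_cycles 0 T = carrier (chain_module 0 T :: ('f, ('a, 'f) field_chain) module)"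
    by (auto simp: field_cycles_def field_chain_boundary_def)
  then have "(chain_module 0 T :: ('f, ('a, 'f) field_chain) module)\<lparr>carrier := field_cycles 0 T\<rparr> =
      chain_module 0 T"
    by (simp add: chain_module_def)
  then show ?thesis
    by (simp add: homology_module_def)
qed

lemma module_homology_0:
  "Module.module ring_of_type_algebra
    (homology_module 0 T :: ('f::field, ('a, 'f) field_chain set) module)"
  unfolding homology_module_0
  by (rule module_quotient_module[OF module_chain_module submodule_field_boundaries])

lemma homology_0_cases:
  assumes "A \<in> carrier (homology_module 0 T)"
  obtains c where "c \<in> carrier (chain_module 0 T)"
    and "A = field_boundaries 0 T +>\<^bsub>chain_module 0 T\<^esub> c"
  using assms by (auto simp: homology_module_0 carrier_quotient_module)

lemma homology_map_coset:
  assumes "continuous_map S T g" and "c \<in> carrier (chain_module p S)"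
  shows "homology_map p T g (field_boundaries p S +>\<^bsub>chain_module p S\<^esub> c) =
    field_boundaries p T +>\<^bsub>chain_module p T\<^esub> field_chain_map p g c"
  unfolding homology_map_def
  using assms linear_field_chain_map field_chain_map_boundaries
  by (intro UN_rcoset_linear[OF module_chain_module submodule_field_boundaries
        module_chain_module submodule_field_boundaries])

lemma linear_homology_map_0:
  assumes "continuous_map S T g"
  shows "linear_map_on ring_of_type_algebra (homology_module 0 S) (homology_module 0 T)
    (homology_map 0 T g)"
proof -
  note simps = homology_map_coset[OF assms] field_chain_map_in_carrier[OF _ assms]
    add_quotient_module[OF module_chain_module submodule_field_boundaries]
    smult_quotient_module[OF module_chain_module submodule_field_boundaries]
  show ?thesis
    by (auto simp: linear_map_on_def homology_module_0 carrier_quotient_module simps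
        chain_module_carrier_closed field_chain_map_add field_chain_map_scale)
qed

text \<open>Functoriality, with the composite given as any \<open>h\<close> that agrees with it on
  \<open>S\<close>. The choice of \<open>h\<close> covers composed inclusions, both sides of a
  naturality square, and a pair of inverse maps.\<close>

lemma homology_map_0_compose:
  assumes "continuous_map S T g" and "continuous_map T W g'"
    and "\<And>x. x \<in> topspace S \<Longrightarrow> g' (g x) = h x"
    and "A \<in> carrier (homology_module 0 S)"
  shows "homology_map 0 W g' (homology_map 0 T g A) = homology_map 0 W h A"
proof -
  have h: "continuous_map S W h"
    using continuous_map_compose[OF assms(1,2)] by (rule continuous_map_eq) (simp add: assms(3))
  obtain c where c: "c \<in> carrier (chain_module 0 S)"
    "A = field_boundaries 0 S +>\<^bsub>chain_module 0 S\<^esub> c"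
    using assms(4) by (rule homology_0_cases)
  then show ?thesis
    using field_chain_map_in_carrier[OF c(1) assms(1)]
    by (simp add: homology_map_coset[OF assms(1)] homology_map_coset[OF assms(2)]
        homology_map_coset[OF h] field_chain_map_compose[where g = g and g' = g' and h = h, OF c(1) assms(3)])
qed

lemma homology_map_0_ident:
  assumes "\<And>x. x \<in> topspace S \<Longrightarrow> g x = x" and "A \<in> carrier (homology_module 0 S)"
  shows "homology_map 0 S g A = A"
proof -
  have g: "continuous_map S S g"
    using continuous_map_id by (rule continuous_map_eq) (simp add: assms(1))
  obtain c where c: "c \<in> carrier (chain_module 0 S)"
    "A = field_boundaries 0 S +>\<^bsub>chain_module 0 S\<^esub> c"
    using assms(2) by (rule homology_0_cases)
  then show ?thesis
    by (simp add: homology_map_coset[OF g] field_chain_map_ident[OF c(1) assms(1)])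
qed


section \<open>Persistence modules of sublevel sets and the morphisms between them\<close>

section \<open>The persistence module of a function on the disk\<close>

lemma theta_mono: "s \<le> t \<Longrightarrow> theta s \<le> theta t"
proof -
  assume "s \<le> t"
  \<comment> \<open>Here \<open>exp r\<close> occurs only once, which makes the monotonicity
    visible.\<close>
  have *: "theta r = 1 - 2 / (exp r + 1)" for r
    using add_pos_pos[OF exp_gt_zero[of r] zero_less_one] by (simp add: theta_def divide_simps)
  show ?thesis
    using \<open>s \<le> t\<close> unfolding * by (intro diff_left_mono divide_left_mono) (auto simp: add_pos_pos)
qed

lemma continuous_map_sublevel_inclusion:
  assumes "s \<le> t"
  shows "continuous_map (top_of_set (sublevel u s)) (top_of_set (sublevel u t)) (\<lambda>z. z)"
  using theta_mono[OF assms] by (auto simp: sublevel_def)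

lemma module_zero_homology:
  "Module.module ring_of_type_algebra
    (zero_homology :: ('f::field, ('a, 'f) field_chain set) module)"
  by (intro moduleI abelian_groupI cring_from_type_algebra) (auto simp: zero_homology_def)

lemma module_induced_space:
  "Module.module ring_of_type_algebra
    (induced_space u t :: ('f::field, (complex, 'f) field_chain set) module)"
  by (simp add: induced_space_def module_homology_0 module_zero_homology)

lemma linear_map_on_zero:
  assumes "Module.module F N"
  shows "linear_map_on F M N (\<lambda>x. \<zero>\<^bsub>N\<^esub>)"
proof -
  interpret module F N by fact
  show ?thesis
    by (auto simp: linear_map_on_def)
qed

text \<open>Preservation of zero is not a clause of \<open>linear_map_on\<close>; it follows by
  cancelling in f 0 + f 0 = f 0. It settles the cases in which a transition starts at a nonpositive
  parameter.\<close>

lemma linear_map_on_imp_zero: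
  assumes "Module.module F M" "Module.module F N" "linear_map_on F M N f"
  shows "f \<zero>\<^bsub>M\<^esub> = \<zero>\<^bsub>N\<^esub>"
proof -
  interpret M: module F M by fact
  interpret N: module F N by fact
  have "f \<zero>\<^bsub>M\<^esub> \<oplus>\<^bsub>N\<^esub> f \<zero>\<^bsub>M\<^esub> = f \<zero>\<^bsub>M\<^esub>" "f \<zero>\<^bsub>M\<^esub> \<in> carrier N"
    using assms(3) M.zero_closed M.l_zero[OF M.zero_closed]
    unfolding linear_map_on_def by (metis, blast)
  then show ?thesis
    using N.M.add.l_cancel_one by simp
qed

lemma induced_space_nonpos:
  assumes "t \<le> 0"
  shows "carrier (induced_space u t :: ('f::field, _) module) =
    {\<zero>\<^bsub>induced_space u t :: ('f, _) module\<^esub>}"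
  using assms by (simp add: induced_space_def zero_homology_def)

lemma linear_transition:
  assumes "s \<le> t"
  shows "linear_map_on ring_of_type_algebra (induced_space u s) (induced_space u t)
    (transition (induced_persistence u :: ('f::field, _) persistence) s t)"
proof (cases "s > 0")
  case True
  with assms show ?thesis
    using linear_homology_map_0[OF continuous_map_sublevel_inclusion[OF assms]]
    by (simp add: induced_space_def induced_persistence_def)
next
  case False
  then show ?thesis
    using linear_map_on_zero[OF module_induced_space] by (simp add: induced_persistence_def)
qed

lemma persistence_module_induced:
  "persistence_module (ring_of_type_algebra :: 'f::field ring)
    (induced_persistence u :: ('f, (complex, 'f) field_chain set) persistence)"
proof -
  let ?U = "induced_persistence u :: ('f, (complex, 'f) field_chain set) persistence"
  have V: "vspace ?U = induced_space u"
    by (simp add: induced_persistence_def)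
  have comp: "transition ?U s r x = transition ?U t r (transition ?U s t x)"
    if "s \<le> t" "t \<le> r" and x: "x \<in> carrier (induced_space u s)" for s t r x
  proof (cases "s > 0")
    case True
    then show ?thesis
      using that homology_map_0_compose[OF continuous_map_sublevel_inclusion[OF that(1)]
          continuous_map_sublevel_inclusion[OF that(2)], where h = "\<lambda>z. z" and A = x]
      by (simp add: induced_persistence_def induced_space_def)
  next
    case False
    \<comment> \<open>A transition out of a nonpositive parameter is the zero map, whatever the sign
      of the target parameter, and the next transition preserves zero.\<close>
    then have "transition ?U s q x = \<zero>\<^bsub>induced_space u q :: ('f, _) module\<^esub>" for q
      by (simp add: induced_persistence_def)
    moreover have "transition ?U t r \<zero>\<^bsub>induced_space u t :: ('f, _) module\<^esub> =
        \<zero>\<^bsub>induced_space u r :: ('f, _) module\<^esub>"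
      by (rule linear_map_on_imp_zero[OF module_induced_space module_induced_space
            linear_transition[OF that(2)]])
    ultimately show ?thesis by simp
  qed
  have ident: "transition ?U t t x = x" if "x \<in> carrier (induced_space u t)" for t x
  proof (cases "t > 0")
    case True
    then show ?thesis
      using that homology_map_0_ident[of "top_of_set (sublevel u t)" "\<lambda>z. z" x]
      by (simp add: induced_persistence_def induced_space_def)
  next
    case False
    then show ?thesis
      using that by (simp add: induced_persistence_def induced_space_nonpos)
  qed
  have "\<exists>s\<^sub>0. \<forall>s\<le>s\<^sub>0. carrier (induced_space u s :: ('f, _) module) =
      {\<zero>\<^bsub>induced_space u s :: ('f, _) module\<^esub>}"
    using induced_space_nonpos by blast
  then show ?thesis
    unfolding persistence_module_def V
    by (intro conjI allI impI ballI field_from_type_algebra module_induced_space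
        linear_transition comp ident)
qed

text \<open>The component at \<open>t\<close> of the morphism induced by \<open>g\<close>, from the
  module of a function u with v o g = u to that of \<open>v\<close>. The source function is absent
  because \<open>homology_map\<close> mentions only the target space.\<close>

definition induced_map ::
    "(complex \<Rightarrow> complex) \<Rightarrow> (complex \<Rightarrow> complex) \<Rightarrow> real \<Rightarrow>
     (complex, 'f::field) field_chain set \<Rightarrow> (complex, 'f) field_chain set" where
  "induced_map v g t =
     (if t > 0 then homology_map 0 (top_of_set (sublevel v t)) g
      else (\<lambda>A. \<zero>\<^bsub>induced_space v t :: ('f, _) module\<^esub>))"

text \<open>From v o g = u it follows that |v(g z)| = |u z|, so \<open>g\<close> respects every
  level at once, with no shift of \<open>t\<close>.\<close>

lemma continuous_map_sublevel:
  assumes "continuous_on (ball 0 1) g" and "g ` ball 0 1 \<subseteq> ball 0 1"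
    and "\<And>z. z \<in> ball 0 1 \<Longrightarrow> v (g z) = u z"
  shows "continuous_map (top_of_set (sublevel u t)) (top_of_set (sublevel v t)) g"
  using assms continuous_on_subset[OF assms(1), of "sublevel u t"]
  by (fastforce simp: sublevel_def)

lemma persistence_morphism_induced_map:
  assumes "continuous_on (ball 0 1) g" and "g ` ball 0 1 \<subseteq> ball 0 1"
    and "\<And>z. z \<in> ball 0 1 \<Longrightarrow> v (g z) = u z"
  shows "persistence_morphism (ring_of_type_algebra :: 'f::field ring)
    (induced_persistence u :: ('f, (complex, 'f) field_chain set) persistence)
    (induced_persistence v) (induced_map v g)"
proof -
  let ?U = "induced_persistence u :: ('f, (complex, 'f) field_chain set) persistence"
  let ?V = "induced_persistence v :: ('f, (complex, 'f) field_chain set) persistence"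
  note cont = continuous_map_sublevel[where u = u and v = v, OF assms]
  have linear: "linear_map_on ring_of_type_algebra (induced_space u t)
      (induced_space v t :: ('f, _) module) (induced_map v g t)" for t
    using linear_homology_map_0[OF cont, of t]
      linear_map_on_zero[OF module_induced_space[of v t, where ?'f = 'f]]
    by (cases "t > 0") (simp_all add: induced_map_def induced_space_def)
  have natural: "induced_map v g t (transition ?U s t x) = transition ?V s t (induced_map v g s x)"
    if "s \<le> t" and x: "x \<in> carrier (induced_space u s)" for s t x
  proof (cases "s > 0")
    case True
    then have "x \<in> carrier (homology_module 0 (top_of_set (sublevel u s)))"
      using x by (simp add: induced_space_def)
    \<comment> \<open>Inclusions are the identity function, so both ways round the square are
      induced by \<open>g\<close> itself; hence \<open>h = g\<close> in both instances.\<close>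
    then show ?thesis
      using True that
        homology_map_0_compose[OF continuous_map_sublevel_inclusion[OF that(1)] cont, where h = g and A = x]
        homology_map_0_compose[OF cont continuous_map_sublevel_inclusion[OF that(1)], where h = g and A = x]
      by (simp add: induced_persistence_def induced_map_def)
  next
    case False
    then show ?thesis
      using linear_map_on_imp_zero[OF module_induced_space module_induced_space linear]
      by (simp add: induced_persistence_def)
  qed
  show ?thesis
    using linear natural by (simp add: persistence_morphism_def induced_persistence_def)
qed

text \<open>At t > 0 the composite is induced by a map that is the identity on the sublevel set; at
  t \<le> 0 the space has one element. Exchanging the roles of \<open>u\<close> and \<open>v\<close>
  gives the other composite.\<close>

lemma induced_map_inverse:
  assumes "continuous_on (ball 0 1) g" and "g ` ball 0 1 \<subseteq> ball 0 1"
    and "\<And>z. z \<in> ball 0 1 \<Longrightarrow> v (g z) = u z"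
    and "continuous_on (ball 0 1) g'" and "g' ` ball 0 1 \<subseteq> ball 0 1"
    and "\<And>z. z \<in> ball 0 1 \<Longrightarrow> u (g' z) = v z"
    and "\<And>z. z \<in> ball 0 1 \<Longrightarrow> g' (g z) = z"
    and x: "x \<in> carrier (induced_space u t)"
  shows "induced_map u g' t (induced_map v g t x) = x"
proof (cases "t > 0")
  case True
  then have "x \<in> carrier (homology_module 0 (top_of_set (sublevel u t)))"
    using x by (simp add: induced_space_def)
  then show ?thesis
    using True homology_map_0_compose[OF continuous_map_sublevel[where u = u and v = v, OF assms(1-3)]
        continuous_map_sublevel[where u = v and v = u, OF assms(4-6)], where h = "\<lambda>z. z" and A = x]
      homology_map_0_ident[of "top_of_set (sublevel u t)" "\<lambda>z. z" x] assms(7)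
    by (simp add: induced_map_def sublevel_def)
next
  case False
  then show ?thesis
    using x by (simp add: induced_map_def induced_space_nonpos)
qed

theorem lemma3p1:
  fixes u v \<phi> :: "complex \<Rightarrow> complex"
  assumes "inner_function u" and "inner_function v"
    and "disk_automorphism \<phi>"
    and "\<And>z. z \<in> ball 0 1 \<Longrightarrow> v z = u (\<phi> z)"
  shows "persistence_isomorphic (ring_of_type_algebra :: 'f::field ring)
           (induced_persistence u :: ('f, (complex, 'f) field_chain set) persistence)
           (induced_persistence v :: ('f, (complex, 'f) field_chain set) persistence)"
proof -
  define \<psi> where "\<psi> = inv_into (ball 0 1) \<phi>"
  have bij: "bij_betw \<phi> (ball 0 1) (ball 0 1)" and "\<phi> holomorphic_on ball 0 1"
    using assms(3) by (auto simp: disk_automorphism_def)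
  then have cont: "continuous_on (ball 0 1) \<phi>"
    by (intro holomorphic_on_imp_continuous_on)
  have img: "\<phi> ` ball 0 1 = ball 0 1"
    using bij by (rule bij_betw_imp_surj_on)
  have left: "\<psi> (\<phi> z) = z" and right: "\<phi> (\<psi> z) = z" and mem: "\<psi> z \<in> ball 0 1"
    if "z \<in> ball 0 1" for z
    using that bij bij_betw_inv_into[OF bij] unfolding \<psi>_def
    by (auto simp del: mem_ball simp: bij_betw_inv_into_left bij_betw_inv_into_right
        dest: bij_betwE)
  \<comment> \<open>Invariance of domain: a continuous injection of an open set of the plane into
    the plane has a continuous inverse on its image, here the whole disk.\<close>
  have cont': "continuous_on (ball 0 1) \<psi>"
    using continuous_on_inverse_open[OF open_ball cont, of \<psi>] left img by simp
  have sub: "\<phi> ` ball 0 1 \<subseteq> ball 0 1" "\<psi> ` ball 0 1 \<subseteq> ball 0 1"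
    using img mem by auto
  have \<phi>: "\<And>z. z \<in> ball 0 1 \<Longrightarrow> u (\<phi> z) = v z"
    using assms(4) by simp
  \<comment> \<open>By this identity it is \<psi> that maps the sublevel sets of \<open>u\<close>
    into those of \<open>v\<close>. Hence \<psi> induces the morphism from the module of
    \<open>u\<close> to that of \<open>v\<close>, and \<phi> its inverse.\<close>
  have \<psi>: "\<And>z. z \<in> ball 0 1 \<Longrightarrow> v (\<psi> z) = u z"
    using assms(4)[OF mem] right by simp
  have V: "vspace (induced_persistence w) = induced_space w" for w
    by (simp add: induced_persistence_def)
  show ?thesis
    unfolding persistence_isomorphic_def V
    using persistence_module_induced
      persistence_morphism_induced_map[where u = u and v = v, OF cont' sub(2) \<psi>]
      persistence_morphism_induced_map[where u = v and v = u, OF cont sub(1) \<phi>]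
      induced_map_inverse[where u = u and v = v, OF cont' sub(2) \<psi> cont sub(1) \<phi> right]
      induced_map_inverse[where u = v and v = u, OF cont sub(1) \<phi> cont' sub(2) \<psi> left]
    by (intro conjI exI[of _ "induced_map v \<psi>"] exI[of _ "induced_map u \<phi>"]) blast+
qed

end
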